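(* Let $c$ be a constant. Suppose there is a function $f(n)=n^{o(1)}$ such that $\mathrm{vuufg}(n,W)\le f(n)\,W^c$ for all $n$ and $W$. Then there is a function $g(n)=n^{o(1)}$ such that $\mathrm{vfg}(n,W)\le g(n)\,W^c$ for all $n$ and $W$.
   Context: For a directed graph $G=(V,E)$ with nonnegative vertex weights $w$, $\mathrm{vdist}_w(s,t)$ is the minimum over $s\leadsto t$ paths $\pi$ of the total weight of the interior vertices of $\pi$ (excluding $s,t$). A set $X\subseteq V$ is an integral vertex cut for the pairs at vertex-weighted distance $\ge1$ if for every pair $(s,t)$ with $\mathrm{vdist}_w(s,t)\ge1$, every $s\leadsto t$ path contains an internal node in $X$. The vertex flow-cut gap $\mathrm{vfg}(n,W)$ is the least integer such that for every $n$-node directed graph $G=(V,E)$ with nonnegative vertex costs $\mathrm{cost}$ and nonnegative vertex weights $w$ with $w(V)=W$, there is such an integral vertex cut $X$ with $\mathrm{cost}(X)\le\langle\mathrm{cost},w\rangle\cdot\mathrm{vfg}(n,W)$, where $\mathrm{cost}(X)=\sum_{v\in X}\mathrm{cost}(v)$ and $\langle\mathrm{cost},w\rangle=\sum_{v\in V}\mathrm{cost}(v)w(v)$. $\mathrm{vuufg}(n,W)$ is defined the same way, but only over instances in which every vertex has $\mathrm{cost}(v)=1$ and all vertices have the same weight $w(v)=k$ for some value $k$. *)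

theory Defs
  imports
    Complex_Main
    "HOL-Library.Extended_Real"
    "HOL-Library.Landau_Symbols"
    "Graph_Theory.Pair_Digraph"
    "Graph_Theory.Vertex_Walk"
begin

definition interior_vertices :: "'a list \<Rightarrow> 'a list" where
  "interior_vertices p = butlast (tl p)"

(* Paths are simple. Passing from a walk between distinct vertices to a simple path only removes
   interior vertices, so admitting walks would change neither distances nor cuts. For s = t the
   only path is [s], so vdist G w s s = 0 for s in V. *)
definition st_paths :: "'a pair_pre_digraph \<Rightarrow> 'a \<Rightarrow> 'a \<Rightarrow> 'a list set" where
  "st_paths G s t = {p. vpath p (with_proj G) \<and> hd p = s \<and> last p = t}"

(* The value is \<infinity> if t is unreachable from s; in a finite digraph the infimum is
   otherwise a minimum. *)
definition vdist :: "'a pair_pre_digraph \<Rightarrow> ('a \<Rightarrow> real) \<Rightarrow> 'a \<Rightarrow> 'a \<Rightarrow> ereal" where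
  "vdist G w s t = (INF p \<in> st_paths G s t. ereal (\<Sum>v\<leftarrow>interior_vertices p. w v))"

definition integral_vertex_cut ::
    "'a pair_pre_digraph \<Rightarrow> ('a \<Rightarrow> real) \<Rightarrow> 'a set \<Rightarrow> bool" where
  "integral_vertex_cut G w X \<longleftrightarrow> X \<subseteq> pverts G \<and>
     (\<forall>s\<in>pverts G. \<forall>t\<in>pverts G. vdist G w s t \<ge> 1 \<longrightarrow>
        (\<forall>p\<in>st_paths G s t. \<exists>v\<in>set (interior_vertices p). v \<in> X))"

definition cost_weight :: "'a set \<Rightarrow> ('a \<Rightarrow> real) \<Rightarrow> ('a \<Rightarrow> real) \<Rightarrow> real" where
  "cost_weight V cost w = (\<Sum>v\<in>V. cost v * w v)"

(* Every finite digraph is isomorphic to one whose vertices are natural numbers. *)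
definition instance_of ::
    "nat \<Rightarrow> real \<Rightarrow> nat pair_pre_digraph \<Rightarrow> (nat \<Rightarrow> real) \<Rightarrow> (nat \<Rightarrow> real) \<Rightarrow> bool" where
  "instance_of n W G cost w \<longleftrightarrow>
     pair_fin_digraph G \<and> card (pverts G) = n \<and>
     (\<forall>v\<in>pverts G. cost v \<ge> 0) \<and> (\<forall>v\<in>pverts G. w v \<ge> 0) \<and>
     (\<Sum>v\<in>pverts G. w v) = W"

definition unit_uniform ::
    "nat pair_pre_digraph \<Rightarrow> (nat \<Rightarrow> real) \<Rightarrow> (nat \<Rightarrow> real) \<Rightarrow> bool" where
  "unit_uniform G cost w \<longleftrightarrow>
     (\<forall>v\<in>pverts G. cost v = 1) \<and> (\<exists>k. \<forall>v\<in>pverts G. w v = k)"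

definition gap_bound ::
    "(nat pair_pre_digraph \<Rightarrow> (nat \<Rightarrow> real) \<Rightarrow> (nat \<Rightarrow> real) \<Rightarrow> bool) \<Rightarrow> nat \<Rightarrow> real \<Rightarrow> nat \<Rightarrow> bool" where
  "gap_bound P n W K \<longleftrightarrow>
     (\<forall>G cost w. instance_of n W G cost w \<and> P G cost w \<longrightarrow>
        (\<exists>X. integral_vertex_cut G w X \<and>
             (\<Sum>v\<in>X. cost v) \<le> cost_weight (pverts G) cost w * real K))"

(* K = n always works, by rounding up the vertices of weight at least 1/n. *)
lemma gap_bound_exists: "gap_bound P n W n"
  unfolding gap_bound_def
proof (intro allI impI)
  fix G cost w
  assume "instance_of n W G cost w \<and> P G cost w"
  then have fin: "finite (pverts G)" and card: "card (pverts G) = n"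
    and cost: "\<And>v. v \<in> pverts G \<Longrightarrow> cost v \<ge> 0" and w: "\<And>v. v \<in> pverts G \<Longrightarrow> w v \<ge> 0"
    by (auto simp: instance_of_def pair_fin_digraph.pair_finite_verts)
  define X where "X = {v \<in> pverts G. w v * real n \<ge> 1}"
  have "\<exists>v\<in>set (interior_vertices p). v \<in> X" if d: "vdist G w s t \<ge> 1" and p: "p \<in> st_paths G s t" for s t p
  proof (rule ccontr)
    assume no: "\<not> ?thesis"
    have "1 \<le> ereal (\<Sum>v\<leftarrow>interior_vertices p. w v)"
      using d INF_lower[OF p, of "\<lambda>p. ereal (\<Sum>v\<leftarrow>interior_vertices p. w v)"] unfolding vdist_def
      by (rule order_trans)
    moreover have dist: "distinct (interior_vertices p)" and sub: "set (interior_vertices p) \<subseteq> pverts G"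
      using p by (auto simp: st_paths_def interior_vertices_def vpath_def vwalk_def distinct_butlast
          distinct_tl dest!: in_set_butlastD list.set_sel(2)[rotated])
    ultimately have ge: "1 \<le> (\<Sum>v\<in>set (interior_vertices p). w v)"
      by (simp add: sum_list_distinct_conv_sum_set one_ereal_def)
    then have ne: "set (interior_vertices p) \<noteq> {}" by auto
    have "(\<Sum>v\<in>set (interior_vertices p). w v * real n) < (\<Sum>v\<in>set (interior_vertices p). 1)"
      using ne no sub by (intro sum_strict_mono) (auto simp: X_def not_le)
    also have "\<dots> \<le> real n"
      using card_mono[OF fin sub] card by simp
    finally have "(\<Sum>v\<in>set (interior_vertices p). w v) * real n < real n"
      by (simp add: sum_distrib_right)
    with ge show False
      by (metis linorder_not_less mult_le_cancel_right1 of_nat_less_0_iff)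
  qed
  then have "integral_vertex_cut G w X"
    unfolding integral_vertex_cut_def by (auto simp: X_def)
  moreover have "(\<Sum>v\<in>X. cost v) \<le> cost_weight (pverts G) cost w * real n"
  proof -
    have "(\<Sum>v\<in>X. cost v) \<le> (\<Sum>v\<in>X. cost v * (w v * real n))"
      proof (rule sum_mono)
      fix v assume "v \<in> X"
      then show "cost v \<le> cost v * (w v * real n)"
        using mult_left_mono[of 1 "w v * real n" "cost v"] cost by (simp add: X_def)
    qed
    also have "\<dots> \<le> (\<Sum>v\<in>pverts G. cost v * (w v * real n))"
      using fin cost w by (intro sum_mono2) (auto simp: X_def)
    finally show ?thesis
      by (simp add: cost_weight_def sum_distrib_right mult.assoc)
  qed
  ultimately show "\<exists>X. integral_vertex_cut G w X \<and>
      (\<Sum>v\<in>X. cost v) \<le> cost_weight (pverts G) cost w * real n" by blast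
qed

(* The least integer is taken among the nonnegative ones. For n > 0 and W > 0 this is automatic,
   since unit costs make \<langle>cost, w\<rangle> = W positive. If W = 0 every integer is admissible, as it is if
   there are no instances (n = 0 < W, or W < 0); the value is then 0. *)
definition vfg :: "nat \<Rightarrow> real \<Rightarrow> nat" where
  "vfg n W = (LEAST K. gap_bound (\<lambda>_ _ _. True) n W K)"

definition vuufg :: "nat \<Rightarrow> real \<Rightarrow> nat" where
  "vuufg n W = (LEAST K. gap_bound unit_uniform n W K)"

(* f(n) = n^o(1) *)
definition subpolynomial :: "(nat \<Rightarrow> real) \<Rightarrow> bool" where
  "subpolynomial f \<longleftrightarrow> (\<exists>h \<in> o(\<lambda>_. 1). \<forall>\<^sub>F n in sequentially. f n = real n powr h n)"

end

theory Submission
  imports Defs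
begin

text \<open>
  Cap the weights at 1, which does not change the pairs at distance at least 1, and scale the costs
  so that their inner product with the capped weights \<open>u\<close> is the capped total weight \<open>U\<close>. Raising every
  cost to an integer \<open>c v \<ge> 1\<close> then at most doubles the inner product. Replace each vertex \<open>v\<close> by
  \<open>l v = \<lfloor>2 n u v\<rfloor>\<close> consecutive layers of \<open>c v\<close> copies, completely joined to each other, bypass the
  vertices without layers, and give all vertices weight \<open>1/n\<close>. Rounding down costs a path at most half
  of its weight, so far pairs remain far, while the new instance has total weight at most \<open>6 U\<close> and at
  most \<open>6 n\<^sup>2\<close> vertices. A cut of it pulls back to the vertices one of whose layers it contains.
  Polynomial growth of the number of vertices preserves \<open>n\<close> to the \<open>o(1)\<close>. The exponent cannot be
  negative, because the unit uniform gap stays positive as the weight grows.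
\<close>

section \<open>Simple paths, distances and cuts in terms of lists\<close>

lemma vwalk_arcs_subset_iff_successively:
  "set (vwalk_arcs p) \<subseteq> E \<longleftrightarrow> successively (\<lambda>x y. (x, y) \<in> E) p"
  by (induction p rule: vwalk_arcs.induct) auto

lemma st_paths_iff:
  "p \<in> st_paths G s t \<longleftrightarrow>
     p \<noteq> [] \<and> hd p = s \<and> last p = t \<and> distinct p \<and> set p \<subseteq> pverts G \<and>
     successively (\<lambda>x y. (x, y) \<in> parcs G) p"
  by (auto simp: st_paths_def vpath_def vwalk_def vwalk_arcs_subset_iff_successively)

lemma interior_vertices_Cons_snoc [simp]: "interior_vertices (s # q @ [t]) = q"
  by (simp add: interior_vertices_def)

lemma st_path_decompose:
  assumes "p \<in> st_paths G s t" "s \<noteq> t"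
  obtains q where "p = s # q @ [t]"
proof -
  from assms obtain r where r: "p = s # r" "r \<noteq> []"
    by (cases p) (auto simp: st_paths_iff split: if_splits)
  with assms have "last r = t" by (simp add: st_paths_iff)
  then have "r = butlast r @ [t]" using append_butlast_last_id[OF r(2)] by simp
  then show thesis using r(1) that[of "butlast r"] by simp
qed

lemma interior_vertices_trivial: "p \<in> st_paths G s s \<Longrightarrow> interior_vertices p = []"
  by (cases p) (auto simp: st_paths_iff interior_vertices_def split: if_splits)

lemma interior_vertices_subset:
  assumes "p \<in> st_paths G s t"
  shows "set (interior_vertices p) \<subseteq> pverts G" "distinct (interior_vertices p)"
proof -
  have "set (interior_vertices p) \<subseteq> set p"
    by (metis in_set_butlastD interior_vertices_def list.set_sel(2) subsetI tl_Nil)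
  with assms show "set (interior_vertices p) \<subseteq> pverts G" by (auto simp: st_paths_iff)
  show "distinct (interior_vertices p)"
    using assms by (auto simp: st_paths_iff interior_vertices_def distinct_butlast distinct_tl)
qed

lemma sum_list_interior:
  assumes "p \<in> st_paths G s t"
  shows "(\<Sum>v\<leftarrow>interior_vertices p. w v) = (\<Sum>v\<in>set (interior_vertices p). w v)"
  using interior_vertices_subset(2)[OF assms] by (rule sum_list_distinct_conv_sum_set)

text \<open>Unreachable pairs are covered too: the infimum over no paths is infinite, and the
  right-hand side holds vacuously.\<close>

lemma vdist_ge_1_iff:
  "vdist G w s t \<ge> 1 \<longleftrightarrow> (\<forall>p\<in>st_paths G s t. (\<Sum>v\<leftarrow>interior_vertices p. w v) \<ge> 1)"
  by (simp add: vdist_def le_INF_iff one_ereal_def)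

lemma integral_vertex_cut_iff:
  "integral_vertex_cut G w X \<longleftrightarrow> X \<subseteq> pverts G \<and>
     (\<forall>s\<in>pverts G. \<forall>t\<in>pverts G.
        (\<forall>p\<in>st_paths G s t. (\<Sum>v\<leftarrow>interior_vertices p. w v) \<ge> 1) \<longrightarrow>
        (\<forall>p\<in>st_paths G s t. set (interior_vertices p) \<inter> X \<noteq> {}))"
  unfolding integral_vertex_cut_def vdist_ge_1_iff by blast

section \<open>Walks in relations and the cuts supplied by \<open>vuufg\<close>\<close>

lemma rtrancl_imp_distinct_path:
  assumes "(s, t) \<in> r\<^sup>*"
  shows "\<exists>p. p \<noteq> [] \<and> hd p = s \<and> last p = t \<and> distinct p \<and> successively (\<lambda>x y. (x, y) \<in> r) p"
  using assms
proof (induction rule: rtrancl_induct)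
  case base
  show ?case by (intro exI[of _ "[s]"]) simp
next
  case (step u v)
  then obtain p where p: "p \<noteq> []" "hd p = s" "last p = u" "distinct p"
    "successively (\<lambda>x y. (x, y) \<in> r) p" by blast
  show ?case
  proof (cases "v \<in> set p")
    case True
    then obtain xs ys where xs: "p = xs @ v # ys" by (meson split_list)
    show ?thesis
      using p unfolding xs
      by (intro exI[of _ "xs @ [v]"]) (auto simp: successively_append_iff hd_append)
  next
    case False
    then show ?thesis
      using p step.hyps(2) by (intro exI[of _ "p @ [v]"]) (auto simp: successively_append_iff)
  qed
qed

lemma successively_imp_relpow:
  "p \<noteq> [] \<Longrightarrow> successively (\<lambda>x y. (x, y) \<in> r) p \<Longrightarrow> (hd p, last p) \<in> r ^^ (length p - 1)"
proof (induction p rule: induct_list012)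
  case (3 x y zs)
  then have "(y, last (y # zs)) \<in> r ^^ length zs" by auto
  with 3(4) have "(x, last (y # zs)) \<in> r ^^ Suc (length zs)"
    by (intro relpow_Suc_I2[of x y]) auto
  then show ?case by simp
qed auto

lemma gap_bound_vuufg: "gap_bound unit_uniform n W (vuufg n W)"
  unfolding vuufg_def by (rule LeastI, rule gap_bound_exists)

text \<open>Carries the gap over from digraphs on \<open>nat\<close> to any finite type, so that the
  blowup can use its own datatype of nodes. Simple paths become walks: a walk with
  \<open>Suc m\<close> arcs has \<open>m\<close> interior positions, and cutting means deleting
  every arc into \<open>X\<close> that does not end in \<open>t\<close>.\<close>

lemma unit_uniform_cut:
  fixes V :: "'b set" and E :: "'b rel" and k :: real
  assumes fin: "finite V" and E: "E \<subseteq> V \<times> V" and k: "k \<ge> 0"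
  defines "n \<equiv> card V"
  shows "\<exists>X\<subseteq>V. real (card X) \<le> real n * k * real (vuufg n (real n * k)) \<and>
    (\<forall>s\<in>V. \<forall>t\<in>V. s \<noteq> t \<longrightarrow> (\<forall>m. (s, t) \<in> E ^^ Suc m \<longrightarrow> 1 \<le> k * real m) \<longrightarrow>
       (s, t) \<notin> {(x, y) \<in> E. y \<in> X \<longrightarrow> y = t}\<^sup>*)"
proof -
  obtain e :: "'b \<Rightarrow> nat" where e: "inj_on e V"
    using finite_imp_inj_to_nat_seg[OF fin] by blast
  define f where "f = inv_into V e"
  have fe [simp]: "f (e x) = x" if "x \<in> V" for x
    using e that by (simp add: f_def)
  define G where "G = \<lparr>pverts = e ` V, parcs = map_prod e e ` E\<rparr>"
  have parcsD: "(f x, f y) \<in> E" if "(x, y) \<in> parcs G" for x y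
    using that E by (auto simp: G_def)
  have "pair_fin_digraph G"
    using E fin finite_subset[OF E] by unfold_locales (auto simp: G_def)
  then have "instance_of n (real n * k) G (\<lambda>_. 1) (\<lambda>_. k)"
    using k e by (simp add: instance_of_def n_def G_def card_image)
  moreover have "unit_uniform G (\<lambda>_. 1) (\<lambda>_. k)" by (simp add: unit_uniform_def)
  ultimately obtain X where X: "integral_vertex_cut G (\<lambda>_. k) X"
    and card: "(\<Sum>v\<in>X. 1) \<le> cost_weight (pverts G) (\<lambda>_. 1) (\<lambda>_. k) * real (vuufg n (real n * k))"
    using gap_bound_vuufg[of n "real n * k"] unfolding gap_bound_def by blast
  have "X \<subseteq> e ` V" using X by (auto simp: integral_vertex_cut_def G_def)
  define Y where "Y = {v \<in> V. e v \<in> X}"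
  have "e ` Y = X" using \<open>X \<subseteq> e ` V\<close> by (auto simp: Y_def)
  moreover have "inj_on e Y" using e by (rule inj_on_subset) (auto simp: Y_def)
  ultimately have "card Y = card X" by (metis card_image)
  then have "real (card Y) \<le> real n * k * real (vuufg n (real n * k))"
    using card e by (simp add: cost_weight_def G_def card_image n_def)
  moreover have "(s, t) \<notin> {(x, y) \<in> E. y \<in> Y \<longrightarrow> y = t}\<^sup>*"
    if st: "s \<in> V" "t \<in> V" "s \<noteq> t" and far: "\<And>m. (s, t) \<in> E ^^ Suc m \<Longrightarrow> 1 \<le> k * real m" for s t
  proof
    assume *: "(s, t) \<in> {(x, y) \<in> E. y \<in> Y \<longrightarrow> y = t}\<^sup>*"
    obtain p where p: "p \<noteq> []" "hd p = s" "last p = t" "distinct p"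
      and suc: "successively (\<lambda>x y. (x, y) \<in> {(x, y) \<in> E. y \<in> Y \<longrightarrow> y = t}) p"
      using rtrancl_imp_distinct_path[OF *] by blast
    have suc': "successively (\<lambda>x y. (x, y) \<in> E) p"
      using suc by (rule successively_mono) auto
    have setp: "set q \<subseteq> V" if "successively (\<lambda>x y. (x, y) \<in> E) q" "q \<noteq> []" "hd q \<in> V" for q
      using that E by (induction q rule: induct_list012) auto
    have pV: "set p \<subseteq> V" using setp[OF suc'] p st by auto
    have ep: "map e p \<in> st_paths G (e s) (e t)"
      using p pV suc' inj_on_subset[OF e pV]
      by (auto simp: st_paths_iff hd_map last_map distinct_map G_def successively_map
          intro: successively_mono[OF suc'])
    have est: "e s \<noteq> e t" using st e by (auto dest: inj_onD)
    have "1 \<le> (\<Sum>v\<leftarrow>interior_vertices q. k)" if q: "q \<in> st_paths G (e s) (e t)" for q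
    proof -
      obtain r where r: "q = e s # r @ [e t]" using st_path_decompose[OF q est] .
      have "successively (\<lambda>x y. (x, y) \<in> E) (map f q)"
        using q parcsD by (auto simp: st_paths_iff successively_map intro: successively_mono)
      from successively_imp_relpow[OF _ this] have "(s, t) \<in> E ^^ Suc (length r)"
        using st by (simp add: r hd_map)
      from far[OF this] show ?thesis by (simp add: r sum_list_triv mult.commute)
    qed
    then have "set (interior_vertices (map e p)) \<inter> X \<noteq> {}"
      using X ep st by (auto simp: integral_vertex_cut_iff G_def)
    moreover from p st obtain q where q: "p = s # q @ [t]"
      by (metis append_butlast_last_id append_Nil last_ConsL last_ConsR list.collapse)
    ultimately obtain v where v: "v \<in> set q" "e v \<in> X" by (auto simp: interior_vertices_def butlast_append)
    then have "v \<in> Y" using pV by (auto simp: Y_def q)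
    obtain a b where ab: "q = a @ v # b" using v by (meson split_list)
    \<comment> \<open>The interior vertex \<open>v\<close> has a predecessor on \<open>p\<close>,
      and an arc into \<open>Y\<close> survives only if it ends in \<open>t\<close>. But
      \<open>t\<close> already ends the distinct list \<open>p\<close>.\<close>
    have "v = t" using suc \<open>v \<in> Y\<close> unfolding q ab
      by (cases a rule: rev_cases) (auto simp: successively_append_iff successively_Cons)
    then show False using p v q by auto
  qed
  ultimately show ?thesis by (intro exI[of _ Y]) (auto simp: Y_def)
qed

section \<open>Nonnegativity of the exponent\<close>

text \<open>On the path 0, 1, 2 with weights \<open>W / 3 \<ge> 1\<close> the ends are far apart, so
  a cut must be nonempty, whereas gap 0 leaves only the empty set.\<close>

lemma vuufg_3_pos:
  assumes "W \<ge> 3"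
  shows "vuufg 3 W \<ge> 1"
proof (rule ccontr)
  assume "\<not> vuufg 3 W \<ge> 1"
  then have gap: "gap_bound unit_uniform 3 W 0" using gap_bound_vuufg[of 3 W]
    by (metis less_one not_less)
  define G :: "nat pair_pre_digraph" where "G = \<lparr>pverts = {0, 1, 2}, parcs = {(0, 1), (1, 2)}\<rparr>"
  have "pair_fin_digraph G" by unfold_locales (auto simp: G_def)
  then have "instance_of 3 W G (\<lambda>_. 1) (\<lambda>_. W / 3)"
    using assms by (simp add: instance_of_def G_def)
  moreover have "unit_uniform G (\<lambda>_. 1) (\<lambda>_. W / 3)"
    unfolding unit_uniform_def by blast
  ultimately obtain X where X: "integral_vertex_cut G (\<lambda>_. W / 3) X" "(\<Sum>v\<in>X. 1 :: real) \<le> 0"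
    using gap unfolding gap_bound_def by fastforce
  have "finite X" using X(1) by (auto simp: integral_vertex_cut_def G_def intro: finite_subset)
  with X(2) have "X = {}" by simp
  have "(\<Sum>v\<leftarrow>interior_vertices p. W / 3) \<ge> 1" if p: "p \<in> st_paths G 0 2" for p
  proof -
    obtain q where q: "p = 0 # q @ [2]" using st_path_decompose[OF p] by auto
    with p have "q \<noteq> []" by (auto simp: st_paths_iff G_def)
    then have "real (length q) \<ge> 1" by (cases q) auto
    then have "1 * 1 \<le> real (length q) * (W / 3)" using assms by (intro mult_mono) auto
    then show ?thesis by (simp add: q sum_list_triv)
  qed
  moreover have "[0, 1, 2] \<in> st_paths G 0 2" by (simp add: st_paths_iff G_def)
  ultimately show False
    using X(1) \<open>X = {}\<close> by (auto simp: integral_vertex_cut_iff G_def)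
qed

text \<open>Makes \<open>W powr c\<close> monotone in \<open>W\<close>, on which the later
  comparisons of total weights rest. For negative \<open>c\<close> the assumed bound at
  \<open>n = 3\<close> would tend to 0 as \<open>W\<close> grows.\<close>

lemma exponent_nonneg:
  fixes c :: real
  assumes "\<And>n W. W \<ge> 0 \<Longrightarrow> real (vuufg n W) \<le> f n * W powr c"
  shows "c \<ge> 0"
proof (rule ccontr)
  assume "\<not> c \<ge> 0"
  then have "((\<lambda>W. f 3 * W powr c) \<longlongrightarrow> f 3 * 0) at_top"
    by (intro tendsto_mult tendsto_const tendsto_neg_powr filterlim_ident) auto
  moreover have "\<forall>\<^sub>F W in at_top. 1 \<le> f 3 * W powr c"
    using eventually_ge_at_top[of 3]
  proof eventually_elim
    case (elim W)
    then show ?case using vuufg_3_pos[of W] assms[of W 3] by linarith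
  qed
  ultimately have "1 \<le> f 3 * 0" by (intro tendsto_lowerbound) auto
  then show False by simp
qed

section \<open>The blowup of a digraph: distances and cuts\<close>

datatype 'a node = Src 'a | Snk 'a | Mid 'a nat nat

locale blowup =
  fixes G :: "'a pair_pre_digraph" and l c :: "'a \<Rightarrow> nat"
  assumes fin_digraph: "pair_fin_digraph G" and c_pos: "\<And>v. c v > 0"
begin

abbreviation "V \<equiv> pverts G"
abbreviation "E \<equiv> parcs G"

lemma finite_V: "finite V" and arcD: "(u, v) \<in> E \<Longrightarrow> u \<in> V" "(u, v) \<in> E \<Longrightarrow> v \<in> V"
  using fin_digraph
  by (auto simp: pair_fin_digraph_def pair_fin_digraph_axioms_def pair_wf_digraph_def)

text \<open>
  A vertex \<open>v\<close> becomes \<open>l v\<close> layers of \<open>c v\<close> copies; \<open>Mid v i j\<close> is copy \<open>j\<close> in layer \<open>i\<close>. The terminals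
  \<open>Src v\<close> and \<open>Snk v\<close> stand for \<open>v\<close> as an end of a path: the weight of an end does not count, and a
  vertex with \<open>l v = 0\<close> has no copies.
\<close>

definition light_arcs :: "'a rel" where "light_arcs = {(u, v) \<in> E. l u = 0}"

text \<open>Relates the ends of walks with at least one arc whose interior vertices all have no
  layers; the ends themselves are unrestricted.\<close>

definition skip_arcs :: "'a rel" where "skip_arcs = E O light_arcs\<^sup>*"

lemma skip_arcs_light:
  "(y, u) \<in> skip_arcs \<Longrightarrow> (u, v) \<in> E \<Longrightarrow> l u = 0 \<Longrightarrow> (y, v) \<in> skip_arcs"
  unfolding skip_arcs_def light_arcs_def
  by (auto intro!: relcompI elim: rtrancl_into_rtrancl)

lemma arc_imp_skip_arc: "(u, v) \<in> E \<Longrightarrow> (u, v) \<in> skip_arcs"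
  by (auto simp: skip_arcs_def)

lemma skip_arcs_subset: "skip_arcs \<subseteq> V \<times> V"
proof -
  have "v \<in> V" if "(u, v) \<in> light_arcs\<^sup>*" "u \<in> V" for u v
    using that by (induction rule: rtrancl_induct) (auto simp: light_arcs_def dest: arcD)
  then show ?thesis by (auto simp: skip_arcs_def dest: arcD)
qed

definition nodes :: "'a node set" where
  "nodes = Src ` V \<union> Snk ` V \<union> (\<lambda>(v, i, j). Mid v i j) ` (SIGMA v:V. {..<l v} \<times> {..<c v})"

lemma nodes_simps [simp]:
  "Src v \<in> nodes \<longleftrightarrow> v \<in> V" "Snk v \<in> nodes \<longleftrightarrow> v \<in> V"
  "Mid v i j \<in> nodes \<longleftrightarrow> v \<in> V \<and> i < l v \<and> j < c v"
  by (force simp: nodes_def)+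

lemma finite_nodes: "finite nodes"
  using finite_V by (simp add: nodes_def)

lemma card_nodes: "card nodes = 2 * card V + (\<Sum>v\<in>V. l v * c v)"
proof -
  let ?M = "(\<lambda>(v, i, j). Mid v i j) ` (SIGMA v:V. {..<l v} \<times> {..<c v})"
  have "card ?M = card (SIGMA v:V. {..<l v} \<times> {..<c v})"
    by (intro card_image) (auto simp: inj_on_def)
  also have "\<dots> = (\<Sum>v\<in>V. l v * c v)"
    using finite_V by (simp add: card_SigmaI card_cartesian_product)
  finally have M: "card ?M = (\<Sum>v\<in>V. l v * c v)" .
  have "card (Src ` V \<union> Snk ` V) = card (Src ` V) + card (Snk ` V)"
    using finite_V by (intro card_Un_disjoint) auto
  also have "\<dots> = 2 * card V" by (simp add: card_image inj_on_def)
  finally have S: "card (Src ` V \<union> Snk ` V) = 2 * card V" .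
  have "card nodes = card (Src ` V \<union> Snk ` V) + card ?M"
    unfolding nodes_def using finite_V by (intro card_Un_disjoint) auto
  then show ?thesis using S M by simp
qed

inductive exit_node :: "'a \<Rightarrow> 'a node \<Rightarrow> bool" where
  exit_Src: "v \<in> V \<Longrightarrow> exit_node v (Src v)"
| exit_Mid: "v \<in> V \<Longrightarrow> Suc i = l v \<Longrightarrow> j < c v \<Longrightarrow> exit_node v (Mid v i j)"

lemma exit_node_in_nodes: "exit_node y z \<Longrightarrow> z \<in> nodes"
  by (auto elim!: exit_node.cases)

text \<open>No arc enters a \<open>Src\<close> node and none leaves a \<open>Snk\<close> node, so
  the interior of a walk between terminals consists of copies only.\<close>

inductive_set arcs :: "'a node rel" where
  inner: "v \<in> V \<Longrightarrow> Suc i < l v \<Longrightarrow> j < c v \<Longrightarrow> j' < c v \<Longrightarrow> (Mid v i j, Mid v (Suc i) j') \<in> arcs"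
| enter: "exit_node y z \<Longrightarrow> (y, v) \<in> skip_arcs \<Longrightarrow> 0 < l v \<Longrightarrow> j < c v \<Longrightarrow> (z, Mid v 0 j) \<in> arcs"
| leave: "exit_node y z \<Longrightarrow> (y, v) \<in> skip_arcs \<Longrightarrow> (z, Snk v) \<in> arcs"

lemma arcs_subset: "arcs \<subseteq> nodes \<times> nodes"
  using skip_arcs_subset by (auto elim!: arcs.cases dest: exit_node_in_nodes)

definition interior_length :: "'a list \<Rightarrow> nat" where
  "interior_length p = (\<Sum>v\<leftarrow>interior_vertices p. l v)"

text \<open>\<open>walk_length s m v\<close>: some walk from \<open>s\<close> to \<open>v\<close> has \<open>m\<close> layers in its interior.\<close>

inductive walk_length :: "'a \<Rightarrow> nat \<Rightarrow> 'a \<Rightarrow> bool" for s where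
  first: "(s, v) \<in> E \<Longrightarrow> walk_length s 0 v"
| more: "walk_length s m u \<Longrightarrow> (u, v) \<in> E \<Longrightarrow> walk_length s (m + l u) v"

lemma walk_length_light:
  assumes "(u, v) \<in> light_arcs\<^sup>*" "walk_length s m u"
  shows "walk_length s m v"
  using assms
proof (induction rule: rtrancl_induct)
  case (step y z)
  then have "walk_length s (m + l y) z" by (intro more) (auto simp: light_arcs_def)
  with step show ?case by (simp add: light_arcs_def)
qed

lemma walk_length_skip_first: "(s, v) \<in> skip_arcs \<Longrightarrow> walk_length s 0 v"
  unfolding skip_arcs_def by (auto intro: walk_length_light first)

lemma walk_length_skip_more:
  "walk_length s m u \<Longrightarrow> (u, v) \<in> skip_arcs \<Longrightarrow> walk_length s (m + l u) v"
  unfolding skip_arcs_def by (auto intro: walk_length_light more)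

lemma interior_length_prefix:
  "interior_length (xs @ [v]) \<le> interior_length (xs @ v # ys)"
proof (cases xs)
  case (Cons x xs')
  then show ?thesis
    by (cases ys rule: rev_cases) (auto simp: interior_length_def interior_vertices_def butlast_append)
qed (simp add: interior_length_def interior_vertices_def)

text \<open>The path is built along the walk: a new vertex is appended, and at a repeated vertex the
  path is cut back to its earlier occurrence, which cannot increase the interior length.\<close>

lemma walk_length_imp_path:
  assumes "walk_length s m v"
  shows "\<exists>p\<in>st_paths G s v. interior_length p \<le> m"
proof -
  have extend: "\<exists>q\<in>st_paths G s v. interior_length q \<le> m + (if u = s then 0 else l u)"
    if p: "p \<in> st_paths G s u" "interior_length p \<le> m" and uv: "(u, v) \<in> E" for p u v m
  proof (cases "v \<in> set p")
    case True
    then obtain xs ys where xs: "p = xs @ v # ys" by (meson split_list)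
    have "xs @ [v] \<in> st_paths G s v"
      using p(1) unfolding xs by (auto simp: st_paths_iff successively_append_iff hd_append)
    moreover have "interior_length (xs @ [v]) \<le> m"
      using interior_length_prefix[of xs v ys] p(2) by (simp add: xs)
    ultimately show ?thesis by force
  next
    case False
    have "p @ [v] \<in> st_paths G s v"
      using False p(1) uv by (auto simp: st_paths_iff successively_append_iff dest: arcD)
    \<comment> \<open>For \<open>u = s\<close> the path is \<open>[s]\<close>, so appending
      \<open>v\<close> turns no vertex into an interior one. Otherwise the old end \<open>u\<close>
      becomes interior.\<close>
    moreover have "interior_length (p @ [v]) \<le> m + (if u = s then 0 else l u)"
    proof (cases "u = s")
      case True
      with p have "p = [s]" by (cases p) (auto simp: st_paths_iff split: if_splits)
      then show ?thesis by (simp add: interior_length_def interior_vertices_def)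
    next
      case False
      from st_path_decompose[OF p(1)] False obtain q where "p = s # q @ [u]" by metis
      then show ?thesis using False p(2) by (simp add: interior_length_def interior_vertices_def butlast_append)
    qed
    ultimately show ?thesis by blast
  qed
  show ?thesis using assms
  proof (induction rule: walk_length.induct)
    case (first v)
    have "[s] \<in> st_paths G s s" using first by (auto simp: st_paths_iff dest: arcD)
    then show ?case using extend[of "[s]" s 0 v] first
      by (simp add: interior_length_def interior_vertices_def)
  next
    case (more m u v)
    then obtain p where "p \<in> st_paths G s u" "interior_length p \<le> m" by blast
    from extend[OF this more(2)] obtain q
      where "q \<in> st_paths G s v" "interior_length q \<le> m + (if u = s then 0 else l u)" by blast
    moreover have "m + (if u = s then 0 else l u) \<le> m + l u" by simp
    ultimately show ?case by (meson le_trans)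
  qed
qed

text \<open>A vertex is entered at layer 0, left from its last layer, and crossed one layer per arc.
  So the number of arcs counts all layers of the vertices left behind, plus the \<open>i\<close>
  layers already passed in the current one, plus one for the arc just taken into it.\<close>

lemma arcs_relpow_walk_length:
  assumes "(Src s, z) \<in> arcs ^^ m"
  shows "case z of Src v \<Rightarrow> v = s \<and> m = 0
    | Mid v i j \<Rightarrow> \<exists>m'. walk_length s m' v \<and> m = Suc (m' + i)
    | Snk v \<Rightarrow> \<exists>m'. walk_length s m' v \<and> m = Suc m'"
  using assms
proof (induction m arbitrary: z)
  case (Suc m)
  then obtain y where y: "(Src s, y) \<in> arcs ^^ m" and arc: "(y, z) \<in> arcs" by auto
  \<comment> \<open>In the last layer \<open>i = l u - 1\<close>, so \<open>Suc (m' + i)\<close>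
    equals \<open>m' + l u\<close>, exactly the length after passing \<open>u\<close>. At
    \<open>Src s\<close> both counts are 0.\<close>
  have exit: "walk_length s m v" if "exit_node u y" "(u, v) \<in> skip_arcs" for u v
    using Suc.IH[OF y] that
    by (auto elim!: exit_node.cases dest: walk_length_skip_first walk_length_skip_more)
      (metis Suc_eq_plus1 add.assoc add_Suc_right walk_length_skip_more)
  from arc show ?case
    using Suc.IH[OF y] by cases (auto dest: exit)
qed auto

lemma Src_Snk_relpow_imp_path:
  assumes "(Src s, Snk t) \<in> arcs ^^ Suc m"
  shows "\<exists>p\<in>st_paths G s t. interior_length p \<le> m"
  using arcs_relpow_walk_length[OF assms] walk_length_imp_path by auto

definition blocked :: "'a node set \<Rightarrow> 'a set" where
  "blocked X = {v \<in> V. \<exists>i<l v. \<forall>j<c v. Mid v i j \<in> X}"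

text \<open>Choose for each blocked vertex one layer inside \<open>X\<close>: these layers are
  disjoint, and that of \<open>v\<close> has \<open>c v\<close> nodes.\<close>

lemma sum_c_blocked_le:
  assumes "X \<subseteq> nodes"
  shows "(\<Sum>v\<in>blocked X. c v) \<le> card X"
proof -
  have "\<forall>v\<in>blocked X. \<exists>i. \<forall>j<c v. Mid v i j \<in> X" by (auto simp: blocked_def)
  from bchoice[OF this] obtain i where i: "\<forall>v\<in>blocked X. \<forall>j<c v. Mid v (i v) j \<in> X"
    by blast
  let ?f = "\<lambda>(v, j). Mid v (i v) j"
  have fin: "finite (blocked X)" using finite_V by (simp add: blocked_def)
  have "(\<Sum>v\<in>blocked X. c v) = card (SIGMA v:blocked X. {..<c v})"
    using fin by (simp add: card_SigmaI)
  also have "\<dots> = card (?f ` (SIGMA v:blocked X. {..<c v}))"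
    by (intro card_image[symmetric]) (auto simp: inj_on_def)
  also have "\<dots> \<le> card X"
    using i finite_subset[OF assms finite_nodes] by (intro card_mono) auto
  finally show ?thesis .
qed

text \<open>An unblocked vertex has a copy outside \<open>X\<close> in each of its layers. Since
  consecutive layers are completely joined, these copies can be visited one after the other.\<close>

lemma unblocked_path_lifts:
  assumes p: "s # q @ [t] \<in> st_paths G s t" and q: "set q \<inter> blocked X = {}"
  shows "(Src s, Snk t) \<in> {(x, y) \<in> arcs. y \<in> X \<longrightarrow> y = Snk t}\<^sup>*"
proof -
  define A where "A = {(x, y) \<in> arcs. y \<in> X \<longrightarrow> y = Snk t}"
  \<comment> \<open>Here \<open>y\<close> is the last vertex before \<open>v\<close> that has
    layers, or \<open>s\<close> if there is none; the skip arc from \<open>y\<close> to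
    \<open>v\<close> absorbs the vertices without layers in between.\<close>
  have "\<exists>y z. exit_node y z \<and> (Src s, z) \<in> A\<^sup>* \<and> (y, v) \<in> skip_arcs"
    if "successively (\<lambda>x y. (x, y) \<in> E) (s # r @ [v])" "set r \<inter> blocked X = {}" for r v
    using that
  proof (induction r arbitrary: v rule: rev_induct)
    case Nil
    then show ?case
      by (intro exI[of _ s] exI[of _ "Src s"]) (auto intro: exit_Src arc_imp_skip_arc dest: arcD)
  next
    case (snoc u r)
    have "successively (\<lambda>x y. (x, y) \<in> E) ((s # r @ [u]) @ [v])" using snoc.prems(1) by simp
    then have uv: "(u, v) \<in> E" and su: "successively (\<lambda>x y. (x, y) \<in> E) (s # r @ [u])"
      unfolding successively_append_iff[of _ "s # r @ [u]" "[v]"] by simp_all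
    have "set r \<inter> blocked X = {}" using snoc.prems(2) by auto
    from snoc.IH[OF su this] obtain y z
      where yz: "exit_node y z" "(Src s, z) \<in> A\<^sup>*" "(y, u) \<in> skip_arcs" by blast
    show ?case
    proof (cases "l u = 0")
      case True
      then show ?thesis using yz skip_arcs_light[OF yz(3) uv] by blast
    next
      case False
      have uV: "u \<in> V" using uv by (rule arcD)
      with snoc.prems have free: "\<exists>j<c u. Mid u i j \<notin> X" if "i < l u" for i
        using that by (auto simp: blocked_def)
      have "\<exists>j<c u. (Src s, Mid u i j) \<in> A\<^sup>*" if "i < l u" for i
        using that
      proof (induction i)
        case 0
        then obtain j where j: "j < c u" "Mid u 0 j \<notin> X" using free by blast
        then have "(z, Mid u 0 j) \<in> A" using yz 0 by (auto simp: A_def intro: enter)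
        with yz j show ?case by (meson rtrancl_into_rtrancl)
      next
        case (Suc i)
        then obtain j where j: "j < c u" "(Src s, Mid u i j) \<in> A\<^sup>*" by auto
        obtain j' where j': "j' < c u" "Mid u (Suc i) j' \<notin> X" using free Suc.prems by blast
        then have "(Mid u i j, Mid u (Suc i) j') \<in> A" using j Suc.prems uV
          by (auto simp: A_def intro: inner)
        with j j' show ?case by (meson rtrancl_into_rtrancl)
      qed
      from this[of "l u - 1"] False obtain j where
        "j < c u" "(Src s, Mid u (l u - 1) j) \<in> A\<^sup>*" by auto
      moreover from this False uV have "exit_node u (Mid u (l u - 1) j)"
        by (intro exit_Mid) auto
      ultimately show ?thesis using arc_imp_skip_arc[OF uv] by blast
    qed
  qed
  from this[of q t] p q obtain y z
    where yz: "exit_node y z" "(Src s, z) \<in> A\<^sup>*" "(y, t) \<in> skip_arcs"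
    unfolding st_paths_iff by blast
  then have "(z, Snk t) \<in> A" by (auto simp: A_def intro: leave)
  with yz show ?thesis unfolding A_def by (meson rtrancl_into_rtrancl)
qed

text \<open>A far pair in \<open>G\<close> has far terminals, since walks between them project to
  paths that are no longer. The cut \<open>Y\<close> of the blowup separates these terminals, so no
  path of the pair can lift, and each one meets \<open>blocked Y\<close>.\<close>

lemma cut_of_blowup:
  fixes k :: real
  assumes k: "k > 0"
  defines "N \<equiv> 2 * card V + (\<Sum>v\<in>V. l v * c v)"
  shows "\<exists>X\<subseteq>V. (\<Sum>v\<in>X. real (c v)) \<le> real N * k * real (vuufg N (real N * k)) \<and>
    (\<forall>s\<in>V. \<forall>t\<in>V. (\<forall>p\<in>st_paths G s t. 1 \<le> k * real (interior_length p)) \<longrightarrow>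
       (\<forall>p\<in>st_paths G s t. set (interior_vertices p) \<inter> X \<noteq> {}))"
proof -
  have card_N: "card nodes = N" by (simp add: card_nodes N_def)
  obtain Y where Y: "Y \<subseteq> nodes" "real (card Y) \<le> real N * k * real (vuufg N (real N * k))"
    and cut: "\<forall>s\<in>nodes. \<forall>t\<in>nodes. s \<noteq> t \<longrightarrow>
       (\<forall>m. (s, t) \<in> arcs ^^ Suc m \<longrightarrow> 1 \<le> k * real m) \<longrightarrow>
       (s, t) \<notin> {(x, y) \<in> arcs. y \<in> Y \<longrightarrow> y = t}\<^sup>*"
    using unit_uniform_cut[OF finite_nodes arcs_subset less_imp_le[OF k]]
    unfolding card_N by (elim exE conjE) (rule that)
  have hits: "set (interior_vertices p) \<inter> blocked Y \<noteq> {}"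
    if st: "s \<in> V" "t \<in> V" and far: "\<And>p. p \<in> st_paths G s t \<Longrightarrow> 1 \<le> k * real (interior_length p)"
      and p: "p \<in> st_paths G s t" for s t p
  proof (cases "s = t")
    case True
    \<comment> \<open>The trivial path has interior length 0, so \<open>s = t\<close> is never a far
      pair.\<close>
    then show ?thesis using far[OF p] p by (simp add: interior_length_def interior_vertices_trivial)
  next
    case False
    then obtain q where q: "p = s # q @ [t]" using st_path_decompose[OF p] by blast
    have "1 \<le> k * real m" if m: "(Src s, Snk t) \<in> arcs ^^ Suc m" for m
    proof -
      obtain r where r: "r \<in> st_paths G s t" "interior_length r \<le> m"
        using Src_Snk_relpow_imp_path[OF m] by blast
      then have "k * real (interior_length r) \<le> k * real m" using k by (intro mult_left_mono) auto
      with far[OF r(1)] show ?thesis by linarith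
    qed
    then have "(Src s, Snk t) \<notin> {(x, y) \<in> arcs. y \<in> Y \<longrightarrow> y = Snk t}\<^sup>*"
      using st by (intro cut[rule_format]) auto
    then show ?thesis using unblocked_path_lifts[of s q t Y] p by (auto simp: q)
  qed
  have "(\<Sum>v\<in>blocked Y. real (c v)) \<le> real N * k * real (vuufg N (real N * k))"
    using sum_c_blocked_le[OF Y(1)] Y(2) by (simp flip: of_nat_sum)
  moreover have "blocked Y \<subseteq> V" by (auto simp: blocked_def)
  ultimately show ?thesis
    by (intro exI[of _ "blocked Y"] conjI ballI impI) (assumption | rule hits | erule bspec)+
qed

end

section \<open>Cuts of weighted instances from cuts of blowups\<close>

text \<open>Two quantities of the blowup must be controlled: its number of nodes \<open>N\<close>,
  at which \<open>f\<close> is evaluated and for which \<open>F\<close> is provided, and its total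
  weight \<open>M = N / n\<close>.\<close>

lemma cut_of_instance:
  fixes f :: "nat \<Rightarrow> real" and c F W :: real
  assumes vuufg: "\<And>n W. W \<ge> 0 \<Longrightarrow> real (vuufg n W) \<le> f n * W powr c" and c: "c \<ge> 0"
    and inst: "instance_of n W G cost w"
    and F: "\<And>m. m \<le> 6 * n\<^sup>2 \<Longrightarrow> f m \<le> F" "F \<ge> 0"
    and capped: "(\<Sum>v\<in>pverts G. min (w v) 1) \<ge> 1"
  shows "\<exists>X. integral_vertex_cut G w X \<and>
    (\<Sum>v\<in>X. cost v) \<le> cost_weight (pverts G) cost w * (6 * F * (6 * W) powr c)"
proof -
  define u where "u = (\<lambda>v. min (w v) 1)"
  define U where "U = (\<Sum>v\<in>pverts G. u v)"
  define D where "D = cost_weight (pverts G) cost u"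
  from inst have digraph: "pair_fin_digraph G" and fin: "finite (pverts G)" and n: "card (pverts G) = n"
    and cost: "\<And>v. v \<in> pverts G \<Longrightarrow> cost v \<ge> 0" and w: "\<And>v. v \<in> pverts G \<Longrightarrow> w v \<ge> 0"
    and W: "(\<Sum>v\<in>pverts G. w v) = W"
    by (auto simp: instance_of_def pair_fin_digraph.pair_finite_verts)
  have u: "0 \<le> u v" "u v \<le> w v" "u v \<le> 1" if "v \<in> pverts G" for v
    using w[OF that] by (auto simp: u_def)
  have U: "1 \<le> U" "U \<le> W" "U \<le> real n"
    using capped sum_mono[of "pverts G" u w] sum_mono[of "pverts G" u "\<lambda>_. 1"] u n W
    by (auto simp: U_def u_def)
  then have n_pos: "real n > 0" by linarith
  have D: "0 \<le> D" "D \<le> cost_weight (pverts G) cost w"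
    unfolding D_def cost_weight_def using cost u by (auto intro!: sum_nonneg sum_mono mult_left_mono)
  show ?thesis
  proof (cases "D = 0")
    case True \<comment> \<open>the costs cannot be normalized, but all vertices of positive weight are free\<close>
    define X where "X = {v \<in> pverts G. w v > 0}"
    have "cost v = 0" if "v \<in> X" for v
    proof -
      have "\<forall>v\<in>pverts G. cost v * u v = 0"
        using True fin cost u by (subst sum_nonneg_eq_0_iff[symmetric]) (auto simp: D_def cost_weight_def)
      with that show ?thesis by (auto simp: X_def u_def)
    qed
    then have "(\<Sum>v\<in>X. cost v) = 0" by simp
    moreover have "set (interior_vertices p) \<inter> X \<noteq> {}"
      if p: "p \<in> st_paths G s t" and far: "1 \<le> (\<Sum>v\<leftarrow>interior_vertices p. w v)" for s t p
    proof
      assume "set (interior_vertices p) \<inter> X = {}"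
      then have "(\<Sum>v\<in>set (interior_vertices p). w v) \<le> 0"
        using interior_vertices_subset(1)[OF p] by (intro sum_nonpos) (force simp: X_def)
      with far show False by (simp add: sum_list_interior[OF p])
    qed
    then have "integral_vertex_cut G w X" by (auto simp: integral_vertex_cut_iff X_def)
    ultimately show ?thesis using D F(2) by (intro exI[of _ X]) simp
  next
    case False
    with D have D_pos: "D > 0" by simp
    define a where "a = U / D"
    have a: "a > 0" using U D_pos by (simp add: a_def)
    \<comment> \<open>Adding 1 instead of rounding up keeps the number of copies positive at
      vertices of cost 0.\<close>
    define copies where "copies = (\<lambda>v. nat \<lfloor>a * cost v\<rfloor> + 1)"
    define layers where "layers = (\<lambda>v. nat \<lfloor>2 * real n * u v\<rfloor>)"
    interpret blowup G layers copies
      using digraph by (intro blowup.intro) (simp_all add: copies_def)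
    have copies: "a * cost v \<le> real (copies v)" "real (copies v) \<le> a * cost v + 1" if "v \<in> V" for v
      using a cost[OF that] by (auto simp: copies_def) linarith+
    have layers: "2 * real n * u v - 1 \<le> real (layers v)" "real (layers v) \<le> 2 * real n * u v"
      if "v \<in> V" for v
      using u[OF that] n_pos by (auto simp: layers_def)
    define N where "N = 2 * card V + (\<Sum>v\<in>V. layers v * copies v)"
    define M where "M = real N * (1 / real n)"
    have "(\<Sum>v\<in>V. real (layers v) * real (copies v)) \<le> (\<Sum>v\<in>V. (2 * real n * u v) * (a * cost v + 1))"
      using copies layers u a cost by (intro sum_mono mult_mono) auto
    also have "\<dots> = 2 * real n * (a * D + U)"
      by (simp add: D_def U_def cost_weight_def sum_distrib_left sum.distrib algebra_simps)
    also have "\<dots> = 4 * real n * U" using D_pos by (simp add: a_def)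
    finally have "real N \<le> 2 * real n + 4 * real n * U" by (simp add: N_def n)
    \<comment> \<open>The \<open>2 * n\<close> terminals are absorbed by means of
      \<open>U \<ge> 1\<close>.\<close>
    also have "\<dots> \<le> 6 * real n * U" using U n_pos by (simp add: algebra_simps)
    finally have N: "real N \<le> 6 * real n * U" .
    then have M: "M \<le> 6 * U" "M \<ge> 0" using n_pos by (auto simp: M_def field_simps)
    \<comment> \<open>Capping gives \<open>U \<le> n\<close>, so the size of the blowup is bounded
      in terms of \<open>n\<close> alone, however large \<open>W\<close> is.\<close>
    have "6 * real n * U \<le> 6 * real n * real n" using U n_pos by (intro mult_left_mono) auto
    with N have "real N \<le> real (6 * n\<^sup>2)" by (simp add: power2_eq_square)
    then have "N \<le> 6 * n\<^sup>2" by (simp only: of_nat_le_iff)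
    have "real (vuufg N M) \<le> f N * M powr c" using vuufg M by simp
    also have "\<dots> \<le> F * (6 * U) powr c"
      using F \<open>N \<le> 6 * n\<^sup>2\<close> M c by (intro mult_mono powr_mono2) auto
    finally have gap: "real (vuufg N M) \<le> F * (6 * U) powr c" .
    obtain X where X: "X \<subseteq> V" "(\<Sum>v\<in>X. real (copies v)) \<le> M * real (vuufg N M)"
      and cut: "\<forall>s\<in>V. \<forall>t\<in>V. (\<forall>p\<in>st_paths G s t. 1 \<le> 1 / real n * real (interior_length p)) \<longrightarrow>
       (\<forall>p\<in>st_paths G s t. set (interior_vertices p) \<inter> X \<noteq> {})"
      using cut_of_blowup[of "1 / real n"] n_pos unfolding N_def[symmetric] M_def[symmetric] by auto
    \<comment> \<open>Capped weight at least 1 gives \<open>2 * n\<close> layers before rounding.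
      Each of the at most \<open>n\<close> interior vertices loses at most one, so at least
      \<open>n\<close> layers of weight \<open>1 / n\<close> remain.\<close>
    have long: "1 \<le> 1 / real n * real (interior_length p)"
      if p: "p \<in> st_paths G s t" and far: "1 \<le> (\<Sum>v\<leftarrow>interior_vertices p. w v)" for s t p
    proof -
      let ?I = "set (interior_vertices p)"
      have I: "?I \<subseteq> V" "finite ?I" using interior_vertices_subset(1)[OF p] by auto
      have "1 \<le> (\<Sum>v\<in>?I. u v)"
      proof (cases "\<exists>v\<in>?I. w v \<ge> 1")
        case True
        then obtain v where v: "v \<in> ?I" "u v = 1" by (auto simp: u_def)
        then have "u v \<le> (\<Sum>v\<in>?I. u v)" using I u by (intro member_le_sum) blast+
        with v show ?thesis by simp
      next
        case False
        then have "(\<Sum>v\<in>?I. u v) = (\<Sum>v\<in>?I. w v)" by (intro sum.cong) (auto simp: u_def)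
        then show ?thesis using far by (simp add: sum_list_interior[OF p])
      qed
      then have "2 * real n * 1 \<le> 2 * real n * (\<Sum>v\<in>?I. u v)" using n_pos by (intro mult_left_mono) auto
      moreover have "card ?I \<le> n" using I fin n card_mono by blast
      moreover have "2 * real n * (\<Sum>v\<in>?I. u v) - real (card ?I) = (\<Sum>v\<in>?I. 2 * real n * u v - 1)"
        by (simp add: sum_subtractf sum_distrib_left)
      moreover have "\<dots> \<le> (\<Sum>v\<in>?I. real (layers v))" using layers I by (intro sum_mono) auto
      ultimately have "real n \<le> (\<Sum>v\<in>?I. real (layers v))" by linarith
      also have "\<dots> = real (interior_length p)"
        unfolding interior_length_def sum_list_interior[OF p] by simp
      finally show ?thesis using n_pos by (simp add: field_simps)
    qed
    have "integral_vertex_cut G w X"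
      unfolding integral_vertex_cut_iff
    proof (intro conjI ballI impI)
      fix s t p
      assume "s \<in> V" "t \<in> V" "p \<in> st_paths G s t"
        and "\<forall>p\<in>st_paths G s t. 1 \<le> (\<Sum>v\<leftarrow>interior_vertices p. w v)"
      with cut long show "set (interior_vertices p) \<inter> X \<noteq> {}" by meson
    qed (rule X)
    moreover have "(\<Sum>v\<in>X. cost v) \<le> cost_weight V cost w * (6 * F * (6 * W) powr c)"
    proof -
      have "a * (\<Sum>v\<in>X. cost v) \<le> (\<Sum>v\<in>X. real (copies v))"
        unfolding sum_distrib_left using copies X by (intro sum_mono) auto
      also have "\<dots> \<le> M * real (vuufg N M)" by (rule X)
      also have "\<dots> \<le> (6 * U) * (F * (6 * U) powr c)"
        using M gap by (intro mult_mono) auto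
      \<comment> \<open>Dividing by \<open>a = U / D\<close> trades the factor \<open>U\<close> for
        \<open>D\<close>.\<close>
      finally have "(\<Sum>v\<in>X. cost v) \<le> D * (6 * F * (6 * U) powr c)"
        using D_pos U by (simp add: a_def field_simps)
      also have "\<dots> \<le> cost_weight V cost w * (6 * F * (6 * W) powr c)"
        using D U F(2) c by (intro mult_mono powr_mono2) auto
      finally show ?thesis .
    qed
    ultimately show ?thesis by blast
  qed
qed

text \<open>A weight above 1 would already bring the capped sum to 1, so capping changes nothing and
  the total weight is below 1. Then no pair joined by a path is far.\<close>

lemma empty_cut_of_light_instance:
  assumes "instance_of n W G cost w" and capped: "(\<Sum>v\<in>pverts G. min (w v) 1) < 1"
  shows "integral_vertex_cut G w {}"
proof -
  from assms have fin: "finite (pverts G)" and w: "\<And>v. v \<in> pverts G \<Longrightarrow> w v \<ge> 0"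
    by (auto simp: instance_of_def pair_fin_digraph.pair_finite_verts)
  have "w v \<le> 1" if "v \<in> pverts G" for v
    using member_le_sum[of v "pverts G" "\<lambda>v. min (w v) 1"] that fin w capped by fastforce
  then have W: "(\<Sum>v\<in>pverts G. w v) < 1" using capped by (simp cong: sum.cong add: min_absorb1)
  have "(\<Sum>v\<leftarrow>interior_vertices p. w v) < 1" if p: "p \<in> st_paths G s t" for p s t
    unfolding sum_list_interior[OF p]
    using W sum_mono2[OF fin interior_vertices_subset(1)[OF p], of w] w by fastforce
  then show ?thesis by (force simp: integral_vertex_cut_iff)
qed

lemma vfg_le_of_vuufg_le:
  fixes f :: "nat \<Rightarrow> real" and c F W :: real
  assumes vuufg: "\<And>n W. W \<ge> 0 \<Longrightarrow> real (vuufg n W) \<le> f n * W powr c"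
    and F: "\<And>m. m \<le> 6 * n\<^sup>2 \<Longrightarrow> f m \<le> F" "F \<ge> 1" and W: "W \<ge> 0"
  shows "real (vfg n W) \<le> 12 * 6 powr c * F * W powr c"
proof -
  have c: "c \<ge> 0" using vuufg by (rule exponent_nonneg)
  have vfg_le: "vfg n W \<le> K" if "gap_bound (\<lambda>_ _ _. True) n W K" for K
    unfolding vfg_def using that by (rule Least_le)
  show ?thesis
  proof (cases "W < 1")
    case True
    \<comment> \<open>Gap 0 is needed here, as \<open>W powr c\<close> can be arbitrarily small for
      \<open>W < 1\<close>.\<close>
    have "gap_bound (\<lambda>_ _ _. True) n W 0"
      unfolding gap_bound_def
    proof (intro allI impI, elim conjE)
      fix G cost w
      assume inst: "instance_of n W G cost w"
      then have "(\<Sum>v\<in>pverts G. min (w v) 1) \<le> W" by (auto simp: instance_of_def intro!: sum_mono)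
      with True have "integral_vertex_cut G w {}"
        using empty_cut_of_light_instance[OF inst] by linarith
      then show "\<exists>X. integral_vertex_cut G w X \<and> sum cost X \<le> cost_weight (pverts G) cost w * real 0"
        by (intro exI[of _ "{}"]) simp
    qed
    from vfg_le[OF this] F show ?thesis by simp
  next
    case False
    \<comment> \<open>Since \<open>x \<ge> 1\<close>, rounding it up to an integer at most doubles
      it; this turns the constant 6 into 12.\<close>
    define x where "x = 6 * F * (6 * W) powr c"
    have "1 \<le> (6 * W) powr c" using False c by (intro ge_one_powr_ge_zero) auto
    then have "1 * 1 \<le> F * (6 * W) powr c" using F(2) by (intro mult_mono) auto
    then have x: "x \<ge> 1" by (simp add: x_def)
    have "gap_bound (\<lambda>_ _ _. True) n W (nat \<lceil>x\<rceil>)"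
      unfolding gap_bound_def
    proof (intro allI impI, elim conjE)
      fix G cost w
      assume inst: "instance_of n W G cost w"
      then have C: "cost_weight (pverts G) cost w \<ge> 0"
        by (auto simp: instance_of_def cost_weight_def intro!: sum_nonneg)
      show "\<exists>X. integral_vertex_cut G w X \<and>
          sum cost X \<le> cost_weight (pverts G) cost w * real (nat \<lceil>x\<rceil>)"
      proof (cases "(\<Sum>v\<in>pverts G. min (w v) 1) \<ge> 1")
        case True
        have "x \<le> real (nat \<lceil>x\<rceil>)" by linarith
        then have "cost_weight (pverts G) cost w * x \<le> cost_weight (pverts G) cost w * real (nat \<lceil>x\<rceil>)"
          using C by (rule mult_left_mono)
        moreover have "\<exists>X. integral_vertex_cut G w X \<and> sum cost X \<le> cost_weight (pverts G) cost w * x"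
          unfolding x_def using F by (intro cut_of_instance[OF vuufg c inst] True) auto
        ultimately show ?thesis by (meson order_trans)
      next
        case False
        then show ?thesis using C empty_cut_of_light_instance[OF inst] by (intro exI[of _ "{}"]) auto
      qed
    qed
    from vfg_le[OF this] have "real (vfg n W) \<le> real (nat \<lceil>x\<rceil>)" by simp
    also have "\<dots> \<le> 2 * x" using x by linarith
    also have "\<dots> = 12 * 6 powr c * F * W powr c" using W by (simp add: x_def powr_mult)
    finally show ?thesis .
  qed
qed

section \<open>Subpolynomial functions\<close>

text \<open>The exponent is the logarithm of \<open>g n\<close> to base \<open>n\<close>: it is
  nonnegative by \<open>g n \<ge> 1\<close>, and the second assumption bounds it by every positive
  \<open>e\<close>.\<close>

lemma subpolynomialI:
  assumes ge1: "\<forall>\<^sub>F n in sequentially. 1 \<le> g n"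
    and le: "\<And>e. e > 0 \<Longrightarrow> \<forall>\<^sub>F n in sequentially. g n \<le> real n powr e"
  shows "subpolynomial g"
proof -
  define h where "h = (\<lambda>n. ln (g n) / ln (real n))"
  have "h \<longlonglongrightarrow> 0"
  proof (rule LIMSEQ_I)
    fix r :: real assume "r > 0"
    then have "\<forall>\<^sub>F n in sequentially. g n \<le> real n powr (r / 2)" by (intro le) simp
    with ge1 eventually_ge_at_top[of 2] have "\<forall>\<^sub>F n in sequentially. norm (h n - 0) < r"
    proof eventually_elim
      case (elim n)
      then have "ln (g n) \<le> ln (real n powr (r / 2))" by (subst ln_le_cancel_iff) auto
      with elim \<open>r > 0\<close> have "0 \<le> h n" "h n \<le> r / 2"
        by (auto simp: h_def ln_powr field_simps)
      with \<open>r > 0\<close> show ?case by simp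
    qed
    then show "\<exists>n0. \<forall>n\<ge>n0. norm (h n - 0) < r" by (simp add: eventually_sequentially)
  qed
  then have "h \<in> o(\<lambda>_. 1)" by (intro smalloI_tendsto) auto
  moreover have "\<forall>\<^sub>F n in sequentially. g n = real n powr h n"
    using ge1 eventually_ge_at_top[of 2]
    by eventually_elim (auto simp: h_def powr_def)
  ultimately show ?thesis unfolding subpolynomial_def by blast
qed

lemma subpolynomial_le_powr:
  assumes "subpolynomial f" "e > 0"
  shows "\<forall>\<^sub>F n in sequentially. f n \<le> real n powr e"
proof -
  obtain h where h: "h \<in> o(\<lambda>_. 1)" and f: "\<forall>\<^sub>F n in sequentially. f n = real n powr h n"
    using assms(1) by (auto simp: subpolynomial_def)
  have "\<forall>\<^sub>F n in sequentially. norm (h n) \<le> e * norm (1 :: real)"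
    using landau_o.smallD[OF h assms(2)] .
  with f eventually_ge_at_top[of 1] show ?thesis
    by eventually_elim (auto intro!: powr_mono)
qed

text \<open>The size of the blowup is only known to be at most \<open>6 * n\<^sup>2\<close> and
  \<open>f\<close> may fail to be monotone, hence the maximum.\<close>

lemma subpolynomial_Max:
  fixes f :: "nat \<Rightarrow> real" and C :: real
  assumes f: "subpolynomial f" and C: "C \<ge> 1"
  shows "subpolynomial (\<lambda>n. C * Max (insert 1 (f ` {..6 * n\<^sup>2})))"
proof (rule subpolynomialI)
  have ge1: "1 \<le> Max (insert 1 (f ` {..6 * n\<^sup>2}))" for n by simp
  show "\<forall>\<^sub>F n in sequentially. 1 \<le> C * Max (insert 1 (f ` {..6 * n\<^sup>2}))"
    using mult_mono[OF C ge1] C by (intro always_eventually) auto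
next
  fix e :: real assume e: "e > 0"
  \<comment> \<open>For \<open>n \<ge> 6\<close> every argument \<open>m\<close> is at most
    \<open>n ^ 3\<close>, so \<open>m powr d\<close> is at most \<open>n powr (e / 2)\<close>. The
    other half of the exponent pays for the constants \<open>C\<close> and \<open>B\<close>.\<close>
  define d where "d = e / 6"
  have d: "d > 0" using e by (simp add: d_def)
  obtain m0 where m0: "\<And>m. m \<ge> m0 \<Longrightarrow> f m \<le> real m powr d"
    using subpolynomial_le_powr[OF f d] by (auto simp: eventually_sequentially)
  define B where "B = Max (insert 1 (f ` {..m0}))"
  have B: "B \<ge> 1" unfolding B_def by (intro Max_ge) auto
  have "\<forall>\<^sub>F n in sequentially. C * B \<le> real n powr (e / 2)"
    using eventually_ge_at_top[of "nat \<lceil>(C * B) powr (2 / e)\<rceil>"]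
  proof eventually_elim
    case (elim n)
    then have "(C * B) powr (2 / e) \<le> real n" by linarith
    then have "((C * B) powr (2 / e)) powr (e / 2) \<le> real n powr (e / 2)"
      using e by (intro powr_mono2) auto
    then show ?case using e B C by (simp add: powr_powr)
  qed
  with eventually_ge_at_top[of 6] show "\<forall>\<^sub>F n in sequentially. C * Max (insert 1 (f ` {..6 * n\<^sup>2})) \<le> real n powr e"
  proof eventually_elim
    case (elim n)
    have n1: "real n powr (e / 2) \<ge> 1" using elim e by (intro ge_one_powr_ge_zero) auto
    have "f m \<le> B * real n powr (e / 2)" if m: "m \<le> 6 * n\<^sup>2" for m
    proof (cases "m < m0")
      case True
      then have "f m \<le> B" unfolding B_def by (intro Max_ge) auto
      also have "\<dots> \<le> B * real n powr (e / 2)" using B n1 by simp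
      finally show ?thesis .
    next
      case False
      note m
      also have "6 * n\<^sup>2 \<le> n * n\<^sup>2" using elim by (intro mult_right_mono) auto
      also have "\<dots> = n ^ 3" by (simp add: power3_eq_cube power2_eq_square)
      finally have "m \<le> n ^ 3" .
      then have "real m \<le> real n powr 3"
        using elim by (simp flip: of_nat_power)
      have "f m \<le> real m powr d" using False m0 by simp
      also have "\<dots> \<le> (real n powr 3) powr d"
        using \<open>real m \<le> real n powr 3\<close> d by (intro powr_mono2) auto
      also have "\<dots> = 1 * real n powr (e / 2)" by (simp add: powr_powr d_def del: powr_numeral)
      also have "\<dots> \<le> B * real n powr (e / 2)" using B by (intro mult_right_mono) auto
      finally show ?thesis .
    qed
    moreover have "1 * 1 \<le> B * real n powr (e / 2)" using B n1 by (intro mult_mono) auto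
    ultimately have "Max (insert 1 (f ` {..6 * n\<^sup>2})) \<le> B * real n powr (e / 2)" by auto
    then have "C * Max (insert 1 (f ` {..6 * n\<^sup>2})) \<le> C * (B * real n powr (e / 2))"
      using C by (intro mult_left_mono) auto
    also have "\<dots> \<le> real n powr (e / 2) * real n powr (e / 2)"
      using elim mult_right_mono[of "C * B" "real n powr (e / 2)" "real n powr (e / 2)"] by (simp add: mult.assoc)
    also have "\<dots> = real n powr e" by (simp flip: powr_add)
    finally show ?case .
  qed
qed

theorem theorem4:
  fixes c :: real
  assumes "\<exists>f. subpolynomial f \<and> (\<forall>n W. W \<ge> 0 \<longrightarrow> real (vuufg n W) \<le> f n * W powr c)"
  shows "\<exists>g. subpolynomial g \<and> (\<forall>n W. W \<ge> 0 \<longrightarrow> real (vfg n W) \<le> g n * W powr c)"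
proof -
  obtain f where f: "subpolynomial f" and vuufg: "\<And>n W. W \<ge> 0 \<Longrightarrow> real (vuufg n W) \<le> f n * W powr c"
    using assms by blast
  have "c \<ge> 0" using vuufg by (rule exponent_nonneg)
  then have "12 * 6 powr c \<ge> (1 :: real)" using ge_one_powr_ge_zero[of 6 c] by simp
  with f have "subpolynomial (\<lambda>n. 12 * 6 powr c * Max (insert 1 (f ` {..6 * n\<^sup>2})))"
    by (rule subpolynomial_Max)
  moreover have "real (vfg n W) \<le> 12 * 6 powr c * Max (insert 1 (f ` {..6 * n\<^sup>2})) * W powr c"
    if "W \<ge> 0" for n W
  proof (rule vfg_le_of_vuufg_le[OF vuufg _ _ that])
    fix m assume "m \<le> 6 * n\<^sup>2"
    then show "f m \<le> Max (insert 1 (f ` {..6 * n\<^sup>2}))" by (intro Max_ge) simp_all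
  qed simp_all
  ultimately show ?thesis by blast
qed

end
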